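(* Let $G$ be a connected graph with vertex set $\{1,\dots,n\}$, $n\ge 2$, let $\Phi=(F_1,\dots,F_n)$ be an $n$-tuple of pairwise disjoint graphs with $|V(F_i)|\ge 2$ for all $i$, $\gamma(F_1)=\dots=\gamma(F_n)$ and $\Gamma(F_1)=\dots=\Gamma(F_n)$, and let $G[\Phi]$ be the generalized lexicographic product. Then $G[\Phi]$ is well $\gamma$-dominated if and only if one of the following holds: (i) $G$ is well $\gamma$-dominated and all $F_i$ are complete graphs; or (ii) $G$ is complete and every $F_i$ is well $\gamma$-dominated with $\gamma(F_i)=2$.
   Context: All graphs are finite, simple and undirected. The generalized lexicographic product $G[\Phi]$ is the graph with vertex set $\bigcup_{i=1}^n V(F_i)$ in which each $F_i$ is an induced subgraph, and for $x\in V(F_i)$, $y\in V(F_j)$ with $i\neq j$, $xy$ is an edge iff $ij\in E(G)$. A dominating set is a set $D$ such that every vertex outside $D$ has a neighbor in $D$; it is minimal if no proper subset is dominating. $\gamma(H)$ is the minimum and $\Gamma(H)$ the maximum cardinality of a minimal dominating set of $H$; $H$ is well $\gamma$-dominated (well-dominated) if $\gamma(H)=\Gamma(H)$. *)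

theory Defs
  imports "Graph_Theory.Graph_Theory" "HOL-Library.Disjoint_Sets"
begin

text \<open>
  A finite simple undirected graph is a \<open>pair_graph\<close>: a finite, loop-free, symmetric relation
  \<open>parcs\<close> on a finite vertex set \<open>pverts\<close>; the edge \<open>xy\<close> is the pair of arcs
  \<open>(x, y)\<close>, \<open>(y, x)\<close>.
\<close>

definition dominating_set :: "'a pair_pre_digraph \<Rightarrow> 'a set \<Rightarrow> bool" where
  "dominating_set H D \<longleftrightarrow>
     D \<subseteq> pverts H \<and> (\<forall>v \<in> pverts H - D. \<exists>u \<in> D. (u, v) \<in> parcs H)"

definition minimal_dominating_set :: "'a pair_pre_digraph \<Rightarrow> 'a set \<Rightarrow> bool" where
  "minimal_dominating_set H D \<longleftrightarrow>
     dominating_set H D \<and> (\<forall>D'. D' \<subset> D \<longrightarrow> \<not> dominating_set H D')"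

definition domination_number :: "'a pair_pre_digraph \<Rightarrow> nat" where
  "domination_number H = Min (card ` {D. minimal_dominating_set H D})"

definition upper_domination_number :: "'a pair_pre_digraph \<Rightarrow> nat" where
  "upper_domination_number H = Max (card ` {D. minimal_dominating_set H D})"

definition well_dominated :: "'a pair_pre_digraph \<Rightarrow> bool" where
  "well_dominated H \<longleftrightarrow> domination_number H = upper_domination_number H"

definition complete_graph :: "'a pair_pre_digraph \<Rightarrow> bool" where
  "complete_graph H \<longleftrightarrow> complete_digraph (card (pverts H)) (with_proj H)"

definition gen_lex_product ::
    "'i pair_pre_digraph \<Rightarrow> ('i \<Rightarrow> 'a pair_pre_digraph) \<Rightarrow> 'a pair_pre_digraph" where
  "gen_lex_product G F = \<lparr>
     pverts = (\<Union>i \<in> pverts G. pverts (F i)),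
     parcs = (\<Union>i \<in> pverts G. parcs (F i)) \<union>
       {(x, y). \<exists>i \<in> pverts G. \<exists>j \<in> pverts G. i \<noteq> j \<and> (i, j) \<in> parcs G \<and>
                  x \<in> pverts (F i) \<and> y \<in> pverts (F j)} \<rparr>"

text \<open>
  Since the vertex set is finite, \<open>Min\<close> and \<open>Max\<close> above range over a finite nonempty set.
\<close>

lemma finite_minimal_dominating_sets:
  assumes "finite (pverts H)"
  shows "finite {D. minimal_dominating_set H D}"
  by (rule finite_subset[of _ "Pow (pverts H)"])
     (use assms in \<open>auto simp: minimal_dominating_set_def dominating_set_def\<close>)

lemma ex_minimal_dominating_set:
  assumes "finite (pverts H)"
  shows "{D. minimal_dominating_set H D} \<noteq> {}"
proof -
  let ?S = "{D. dominating_set H D}"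
  have "finite ?S"
    by (rule finite_subset[of _ "Pow (pverts H)"])
       (use assms in \<open>auto simp: dominating_set_def\<close>)
  moreover have "pverts H \<in> ?S" by (simp add: dominating_set_def)
  ultimately obtain D where "D \<in> ?S" "\<And>D'. D' \<in> ?S \<Longrightarrow> D' \<subseteq> D \<Longrightarrow> D = D'"
    using finite_has_minimal[of ?S] by blast
  then have "minimal_dominating_set H D"
    unfolding minimal_dominating_set_def by blast
  then show ?thesis by blast
qed

lemma pair_graph_gen_lex_product:
  assumes G: "pair_graph G" and F: "\<And>i. i \<in> pverts G \<Longrightarrow> pair_graph (F i)"
    and disj: "disjoint_family_on (\<lambda>i. pverts (F i)) (pverts G)"
  shows "pair_graph (gen_lex_product G F)"
proof -
  interpret G: pair_graph G by fact
  let ?P = "gen_lex_product G F"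
  have Fw: "x \<in> pverts (F i) \<and> y \<in> pverts (F i) \<and> x \<noteq> y \<and> (y, x) \<in> parcs (F i)"
    if "i \<in> pverts G" "(x, y) \<in> parcs (F i)" for i x y
  proof -
    interpret Fi: pair_graph "F i" using F that(1) .
    show ?thesis
      using that(2) Fi.in_arcsD1 Fi.in_arcsD2 Fi.no_loops' Fi.arcs_symmetric by blast
  qed
  have V: "finite (pverts ?P)"
    using G.pair_finite_verts F pair_fin_digraph.pair_finite_verts
    by (force simp: gen_lex_product_def pair_graph_def pair_digraph_def)
  have *: "x \<in> pverts ?P \<and> y \<in> pverts ?P \<and> x \<noteq> y \<and> (y, x) \<in> parcs ?P"
    if xy: "(x, y) \<in> parcs ?P" for x y
  proof (cases "\<exists>i \<in> pverts G. (x, y) \<in> parcs (F i)")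
    case True
    then show ?thesis using Fw by (fastforce simp: gen_lex_product_def)
  next
    case False
    then obtain i j where ij: "i \<in> pverts G" "j \<in> pverts G" "i \<noteq> j" "(i, j) \<in> parcs G"
        and x: "x \<in> pverts (F i)" and y: "y \<in> pverts (F j)"
      using xy by (auto simp: gen_lex_product_def)
    have "x \<noteq> y"
      using disj ij x y by (auto simp: disjoint_family_on_def)
    moreover have "x \<in> pverts ?P" "y \<in> pverts ?P"
      using ij x y by (auto simp: gen_lex_product_def)
    moreover have "\<exists>k \<in> pverts G. \<exists>l \<in> pverts G. k \<noteq> l \<and> (k, l) \<in> parcs G \<and>
        y \<in> pverts (F k) \<and> x \<in> pverts (F l)"
      using ij x y G.arcs_symmetric[of i j] by (intro bexI[of _ j] bexI[of _ i]) auto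
    then have "(y, x) \<in> parcs ?P"
      by (simp add: gen_lex_product_def)
    ultimately show ?thesis by blast
  qed
  have A: "finite (parcs ?P)"
    by (rule finite_subset[of _ "pverts ?P \<times> pverts ?P"]) (use * V in auto)
  show ?thesis
    by unfold_locales (use * V A in \<open>auto simp: symmetric_def intro!: symI\<close>)
qed

lemma induced_subgraph_gen_lex_product:
  assumes G: "pair_graph G" and F: "\<And>i. i \<in> pverts G \<Longrightarrow> pair_graph (F i)"
    and disj: "disjoint_family_on (\<lambda>i. pverts (F i)) (pverts G)"
    and i: "i \<in> pverts G"
  shows "induced_subgraph (with_proj (F i)) (with_proj (gen_lex_product G F))"
proof -
  interpret P: pair_graph "gen_lex_product G F"
    using pair_graph_gen_lex_product[OF G F disj] .
  interpret Fi: pair_graph "F i" using F i .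
  have Fw: "x \<in> pverts (F j) \<and> y \<in> pverts (F j)"
    if "j \<in> pverts G" "(x, y) \<in> parcs (F j)" for j x y
  proof -
    interpret Fj: pair_graph "F j" using F that(1) .
    show ?thesis using that(2) Fj.in_arcsD1 Fj.in_arcsD2 by blast
  qed
  have eq: "j = k" if "j \<in> pverts G" "k \<in> pverts G" "x \<in> pverts (F j)" "x \<in> pverts (F k)"
    for j k x
    using disj that by (auto simp: disjoint_family_on_def)
  have "parcs (F i) = {e \<in> parcs (gen_lex_product G F). fst e \<in> pverts (F i) \<and> snd e \<in> pverts (F i)}"
  proof (intro set_eqI iffI)
    fix e assume "e \<in> parcs (F i)"
    then show "e \<in> {e \<in> parcs (gen_lex_product G F). fst e \<in> pverts (F i) \<and> snd e \<in> pverts (F i)}"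
      using i Fw[OF i] by (cases e) (auto simp: gen_lex_product_def)
  next
    fix e assume "e \<in> {e \<in> parcs (gen_lex_product G F). fst e \<in> pverts (F i) \<and> snd e \<in> pverts (F i)}"
    then show "e \<in> parcs (F i)"
      using i Fw eq by (cases e) (auto simp: gen_lex_product_def, metis+)
  qed
  moreover have "pverts (F i) \<subseteq> pverts (gen_lex_product G F)"
    using i by (auto simp: gen_lex_product_def)
  moreover have "parcs (F i) \<subseteq> parcs (gen_lex_product G F)"
    using i by (auto simp: gen_lex_product_def)
  moreover have "wf_digraph (with_proj (F i))" "wf_digraph (with_proj (gen_lex_product G F))"
    by (simp_all only: wf_digraph_wp_iff Fi.pair_wf_digraph P.pair_wf_digraph)
  ultimately show ?thesis
    unfolding induced_subgraph_def subgraph_def compatible_def with_proj_simps by (intro conjI refl)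
qed

end

theory Submission
  imports Defs
begin

text \<open>
  Choosing a minimal dominating set of \<open>F i\<close> for every \<open>i\<close> in an independent dominating set \<open>I\<close>
  of \<open>G\<close> yields a minimal dominating set of the product, so if the product is well-dominated then
  every \<open>F i\<close> is well-dominated, with common domination number \<open>k\<close>, and \<open>k |I|\<close> bounds the size of
  all dominating sets of the product from below.  If \<open>k = 1\<close>, all \<open>F i\<close> are complete and transversals
  identify the minimal dominating sets of \<open>G\<close> with those of the product.  If \<open>k \<ge> 2\<close>, add to \<open>I\<close> one
  neighbour of each of its vertices: a transversal over the resulting total dominating set of \<open>G\<close>
  dominates the product, so \<open>k |I| \<le> 2 |I|\<close> and \<open>k = 2\<close>.  If \<open>G\<close> were not complete, \<open>I\<close> could
  contain both ends of an induced path on three vertices, which may share their added neighbour,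
  and the estimate would improve to the contradiction \<open>2 |I| < 2 |I|\<close>.
\<close>

section \<open>Minimal dominating sets\<close>

lemma dominating_set_iff:
  "dominating_set H D \<longleftrightarrow>
     D \<subseteq> pverts H \<and> (\<forall>v \<in> pverts H. v \<in> D \<or> (\<exists>u \<in> D. (u, v) \<in> parcs H))"
  by (auto simp: dominating_set_def)

lemma dominating_set_mono:
  "dominating_set H D \<Longrightarrow> D \<subseteq> E \<Longrightarrow> E \<subseteq> pverts H \<Longrightarrow> dominating_set H E"
  unfolding dominating_set_iff by blast

text \<open>Domination passes to supersets, so a dominating proper subset of \<open>D\<close> that
  misses \<open>x\<close> makes \<open>D - {x}\<close> dominating too. Minimality can thus be tested
  by removing single vertices.\<close>

lemma minimal_dominating_set_iff:
  "minimal_dominating_set H D \<longleftrightarrow>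
     dominating_set H D \<and> (\<forall>x \<in> D. \<not> dominating_set H (D - {x}))"
proof -
  have "\<not> dominating_set H D'"
    if D: "dominating_set H D" and min: "\<forall>x \<in> D. \<not> dominating_set H (D - {x})" and "D' \<subset> D" for D'
  proof
    assume D': "dominating_set H D'"
    obtain x where "x \<in> D" "x \<notin> D'" using \<open>D' \<subset> D\<close> by blast
    moreover have "dominating_set H (D - {x})"
      using D \<open>x \<notin> D'\<close> \<open>D' \<subset> D\<close> by (intro dominating_set_mono[OF D']) (auto simp: dominating_set_iff)
    ultimately show False using min by blast
  qed
  moreover have "D - {x} \<subset> D" if "x \<in> D" for x using that by blast
  ultimately show ?thesis unfolding minimal_dominating_set_def by metis
qed

lemma finite_dominating_set:
  "finite (pverts H) \<Longrightarrow> dominating_set H D \<Longrightarrow> finite D"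
  by (auto simp: dominating_set_def intro: finite_subset)

lemma dominating_set_contains_minimal:
  assumes "finite (pverts H)" "dominating_set H D"
  obtains E where "E \<subseteq> D" "minimal_dominating_set H E"
proof -
  define S where "S = {E. dominating_set H E \<and> E \<subseteq> D}"
  have "finite S"
    unfolding S_def using finite_dominating_set[OF assms] by (auto intro: finite_subset[of _ "Pow D"])
  moreover have "D \<in> S" using assms by (simp add: S_def)
  ultimately obtain E where E: "E \<in> S" "\<forall>E' \<in> S. E' \<subseteq> E \<longrightarrow> E = E'"
    using finite_has_minimal[of S] by blast
  then show thesis
    by (intro that[of E]) (auto simp: minimal_dominating_set_def S_def)
qed

lemma minimal_dominating_set_nonempty:
  "minimal_dominating_set H D \<Longrightarrow> pverts H \<noteq> {} \<Longrightarrow> D \<noteq> {}"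
  by (auto simp: minimal_dominating_set_def dominating_set_iff)

section \<open>Bounds and attainment for the two domination numbers\<close>

lemma domination_numbers_bound:
  assumes "finite (pverts H)" "minimal_dominating_set H D"
  shows "domination_number H \<le> card D" "card D \<le> upper_domination_number H"
  using finite_minimal_dominating_sets[OF assms(1)] assms(2)
  by (auto simp: domination_number_def upper_domination_number_def)

lemma domination_number_attained:
  assumes "finite (pverts H)"
  obtains D where "minimal_dominating_set H D" "card D = domination_number H"
proof -
  have "domination_number H \<in> card ` {D. minimal_dominating_set H D}"
    unfolding domination_number_def
    using finite_minimal_dominating_sets[OF assms] ex_minimal_dominating_set[OF assms]
    by (intro Min_in) auto
  then show thesis using that by auto
qed

lemma upper_domination_number_attained:
  assumes "finite (pverts H)"
  obtains D where "minimal_dominating_set H D" "card D = upper_domination_number H"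
proof -
  have "upper_domination_number H \<in> card ` {D. minimal_dominating_set H D}"
    unfolding upper_domination_number_def
    using finite_minimal_dominating_sets[OF assms] ex_minimal_dominating_set[OF assms]
    by (intro Max_in) auto
  then show thesis using that by auto
qed

lemma well_dominated_card:
  assumes "finite (pverts H)" "well_dominated H" "minimal_dominating_set H D"
  shows "card D = domination_number H"
  using domination_numbers_bound[OF assms(1,3)] assms(2) by (simp add: well_dominated_def)

lemma well_dominatedI:
  assumes "finite (pverts H)" "\<And>D. minimal_dominating_set H D \<Longrightarrow> card D = k"
  shows "well_dominated H"
  using assms unfolding well_dominated_def
  by (metis domination_number_attained upper_domination_number_attained)

text \<open>The definition minimises over minimal dominating sets only; shrinking \<open>D\<close>
  to a minimal one extends the bound to every dominating set.\<close>

lemma domination_number_le: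
  assumes "finite (pverts H)" "dominating_set H D"
  shows "domination_number H \<le> card D"
proof -
  obtain E where E: "E \<subseteq> D" "minimal_dominating_set H E"
    using dominating_set_contains_minimal[OF assms] .
  then show ?thesis
    using domination_numbers_bound(1)[OF assms(1) E(2)] card_mono[OF finite_dominating_set[OF assms] E(1)]
    by simp
qed

section \<open>Independent dominating sets\<close>

definition independent_set :: "'a pair_pre_digraph \<Rightarrow> 'a set \<Rightarrow> bool" where
  "independent_set H I \<longleftrightarrow> I \<subseteq> pverts H \<and> (\<forall>u \<in> I. \<forall>v \<in> I. (u, v) \<notin> parcs H)"

text \<open>Once \<open>x\<close> is removed from \<open>I\<close>, only an arc inside
  \<open>I\<close> could dominate it, and independence excludes such arcs.\<close>

lemma independent_dominating_set_minimal:
  assumes "independent_set H I" "dominating_set H I"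
  shows "minimal_dominating_set H I"
  unfolding minimal_dominating_set_iff
proof (intro conjI ballI notI)
  fix x assume x: "x \<in> I" "dominating_set H (I - {x})"
  then have "x \<in> pverts H - (I - {x})" using assms(1) by (auto simp: independent_set_def)
  then obtain u where "u \<in> I" "(u, x) \<in> parcs H" using x(2) unfolding dominating_set_def by blast
  then show False using assms(1) x(1) by (simp add: independent_set_def)
qed (rule assms(2))

text \<open>A maximal independent superset of \<open>J\<close> dominates, because an undominated
  vertex could be added to it. The choice of \<open>J\<close> later prescribes vertices of the
  dominating set.\<close>

lemma independent_set_extends:
  assumes "pair_graph H" "independent_set H J"
  obtains I where "J \<subseteq> I" "independent_set H I" "dominating_set H I"
proof -
  interpret H: pair_graph H by fact
  define S where "S = {I. independent_set H I \<and> J \<subseteq> I}"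
  have "finite S"
    unfolding S_def
    by (rule finite_subset[of _ "Pow (pverts H)"]) (auto simp: independent_set_def H.pair_finite_verts)
  moreover have "J \<in> S" using assms by (simp add: S_def)
  ultimately obtain I where "I \<in> S" "\<forall>I' \<in> S. I \<subseteq> I' \<longrightarrow> I = I'"
    using finite_has_maximal[of S] by blast
  then have I: "independent_set H I" "J \<subseteq> I"
    and max: "\<And>I'. independent_set H I' \<Longrightarrow> I \<subseteq> I' \<Longrightarrow> I = I'"
    by (auto simp: S_def)
  have "\<exists>u \<in> I. (u, v) \<in> parcs H" if v: "v \<in> pverts H" "v \<notin> I" for v
  proof (rule ccontr)
    assume "\<not> ?thesis"
    then have "independent_set H (insert v I)"
      using I(1) v H.no_loops' H.arcs_symmetric by (auto simp: independent_set_def)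
    then show False using max[of "insert v I"] v by blast
  qed
  then show thesis
    using I by (intro that[of I]) (auto simp: dominating_set_def independent_set_def)
qed

section \<open>Completeness and connectivity\<close>

lemma complete_graph_iff:
  assumes "pair_graph H"
  shows "complete_graph H \<longleftrightarrow>
    (\<forall>u \<in> pverts H. \<forall>v \<in> pverts H. u \<noteq> v \<longrightarrow> (u, v) \<in> parcs H)"
proof -
  interpret H: pair_graph H by fact
  have "parcs H \<subseteq> {(u, v). (u, v) \<in> pverts H \<times> pverts H \<and> u \<noteq> v}"
    using H.no_loops' H.in_arcsD1 H.in_arcsD2 by auto
  then show ?thesis
    unfolding complete_graph_def complete_digraph_pair_def using H.pair_finite_verts by auto
qed

text \<open>Two distinct nonadjacent vertices would extend to an independent dominating set, which
  is a minimal dominating set with at least two elements.\<close>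

lemma complete_graph_if_upper_domination_number_le_1:
  assumes "pair_graph H" "upper_domination_number H \<le> 1"
  shows "complete_graph H"
  unfolding complete_graph_iff[OF assms(1)]
proof (intro ballI impI)
  interpret H: pair_graph H by fact
  fix u v assume uv: "u \<in> pverts H" "v \<in> pverts H" "u \<noteq> v"
  show "(u, v) \<in> parcs H"
  proof (rule ccontr)
    assume "(u, v) \<notin> parcs H"
    then have "independent_set H {u, v}"
      using uv H.no_loops' H.arcs_symmetric by (auto simp: independent_set_def)
    then obtain I where I: "{u, v} \<subseteq> I" "independent_set H I" "dominating_set H I"
      using independent_set_extends[OF assms(1)] by blast
    have "card {u, v} \<le> card I"
      by (rule card_mono[OF finite_dominating_set[OF H.pair_finite_verts I(3)] I(1)])
    also have "\<dots> \<le> 1"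
      using domination_numbers_bound(2)[OF H.pair_finite_verts independent_dominating_set_minimal[OF I(2,3)]]
        assms(2) by simp
    finally show False using uv by simp
  qed
qed

text \<open>Along a walk from \<open>u\<close>, transitivity keeps every vertex reached equal or
  adjacent to \<open>u\<close>. Read contrapositively, a connected graph that is not complete
  contains an induced path on three vertices.\<close>

lemma connected_transitive_imp_complete:
  assumes "pair_graph H" "Digraph_Component.connected (with_proj H)"
    and trans: "\<And>u v w. (u, v) \<in> parcs H \<Longrightarrow> (v, w) \<in> parcs H \<Longrightarrow> u \<noteq> w \<Longrightarrow> (u, w) \<in> parcs H"
  shows "complete_graph H"
  unfolding complete_graph_iff[OF assms(1)]
proof (intro ballI impI)
  interpret H: pair_graph H by fact
  fix u v assume uv: "u \<in> pverts H" "v \<in> pverts H" "u \<noteq> v"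
  have "strongly_connected (with_proj H)"
    using H.symmetric_connected_imp_strongly_connected assms(2) H.pair_sym_arcs by blast
  then have "u \<rightarrow>\<^sup>*\<^bsub>with_proj H\<^esub> v" using uv by (auto simp: strongly_connected_def)
  then have "u = v \<or> (u, v) \<in> parcs H"
    by (induction rule: H.reachable_induct) (auto dest: trans)
  then show "(u, v) \<in> parcs H" using uv by blast
qed

lemma connected_has_neighbour:
  assumes "pair_graph H" "Digraph_Component.connected (with_proj H)" "card (pverts H) \<ge> 2"
    and "u \<in> pverts H"
  shows "\<exists>v \<in> pverts H. (u, v) \<in> parcs H"
proof -
  interpret H: pair_graph H by fact
  have "pverts H \<noteq> {u}" using assms(3) by auto
  then obtain w where w: "w \<in> pverts H" "w \<noteq> u" using assms(4) by blast
  have "strongly_connected (with_proj H)"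
    using H.symmetric_connected_imp_strongly_connected assms(2) H.pair_sym_arcs by blast
  then have "u \<rightarrow>\<^sup>*\<^bsub>with_proj H\<^esub> w" using w assms(4) by (auto simp: strongly_connected_def)
  then have "u = w \<or> (\<exists>v. (u, v) \<in> parcs H)"
    by (induction rule: H.converse_reachable_induct) auto
  then show ?thesis using w H.in_arcsD2 by blast
qed

section \<open>Domination in the generalized lexicographic product\<close>

locale gen_lex =
  fixes G :: "'i pair_pre_digraph" and F :: "'i \<Rightarrow> 'a pair_pre_digraph"
  assumes graph_G: "pair_graph G"
    and graph_F: "\<And>i. i \<in> pverts G \<Longrightarrow> pair_graph (F i)"
    and disjoint_F: "disjoint_family_on (\<lambda>i. pverts (F i)) (pverts G)"
    and nonempty_F: "\<And>i. i \<in> pverts G \<Longrightarrow> pverts (F i) \<noteq> {}"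
begin

abbreviation "P \<equiv> gen_lex_product G F"

lemma finite_G: "finite (pverts G)"
  using graph_G pair_fin_digraph.pair_finite_verts by (auto simp: pair_graph_def pair_digraph_def)

lemma finite_F: "i \<in> pverts G \<Longrightarrow> finite (pverts (F i))"
  using graph_F pair_fin_digraph.pair_finite_verts by (fastforce simp: pair_graph_def pair_digraph_def)

lemma pverts_P: "pverts P = (\<Union>i \<in> pverts G. pverts (F i))"
  by (simp add: gen_lex_product_def)

lemma finite_P: "finite (pverts P)"
  using finite_G finite_F by (simp add: pverts_P)

lemma index_unique:
  "i \<in> pverts G \<Longrightarrow> j \<in> pverts G \<Longrightarrow> x \<in> pverts (F i) \<Longrightarrow> x \<in> pverts (F j) \<Longrightarrow> i = j"
  using disjoint_F by (auto simp: disjoint_family_on_def)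

lemma parcs_F_pverts:
  assumes "i \<in> pverts G" "(x, y) \<in> parcs (F i)"
  shows "x \<in> pverts (F i)" "y \<in> pverts (F i)"
proof -
  interpret pair_graph "F i" using graph_F assms(1) .
  show "x \<in> pverts (F i)" "y \<in> pverts (F i)" using assms(2) in_arcsD1 in_arcsD2 by blast+
qed

text \<open>Disjointness makes \<open>i\<close> and \<open>j\<close> the only indices of
  \<open>x\<close> and \<open>y\<close>, so exactly one clause of the product's arc set can apply.
  Adjacency arguments in the product rest on this.\<close>

lemma parcs_P_iff:
  assumes "i \<in> pverts G" "j \<in> pverts G" "x \<in> pverts (F i)" "y \<in> pverts (F j)"
  shows "(x, y) \<in> parcs P \<longleftrightarrow> (if i = j then (x, y) \<in> parcs (F i) else (i, j) \<in> parcs G)"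
proof -
  have "(x, y) \<in> parcs P \<longleftrightarrow> (\<exists>k \<in> pverts G. (x, y) \<in> parcs (F k)) \<or>
      (\<exists>k \<in> pverts G. \<exists>l \<in> pverts G. k \<noteq> l \<and> (k, l) \<in> parcs G \<and> x \<in> pverts (F k) \<and> y \<in> pverts (F l))"
    by (simp add: gen_lex_product_def)
  also have "(\<exists>k \<in> pverts G. (x, y) \<in> parcs (F k)) \<longleftrightarrow> i = j \<and> (x, y) \<in> parcs (F i)"
    using assms index_unique parcs_F_pverts by metis
  also have "(\<exists>k \<in> pverts G. \<exists>l \<in> pverts G. k \<noteq> l \<and> (k, l) \<in> parcs G \<and> x \<in> pverts (F k) \<and> y \<in> pverts (F l))
      \<longleftrightarrow> i \<noteq> j \<and> (i, j) \<in> parcs G"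
    using assms index_unique by metis
  finally show ?thesis by auto
qed

lemma complete_factor_arc:
  assumes "i \<in> pverts G" "complete_graph (F i)" "x \<in> pverts (F i)" "y \<in> pverts (F i)"
  shows "y = x \<or> (x, y) \<in> parcs P"
  using assms complete_graph_iff[OF graph_F[OF assms(1)]] parcs_P_iff[of i i x y] by auto

lemma ex_transversal: "\<exists>t. \<forall>i \<in> pverts G. t i \<in> pverts (F i)"
  using nonempty_F by (intro bchoice) blast

lemma no_loop_G: "(i, i) \<notin> parcs G"
proof -
  interpret pair_graph G by (rule graph_G)
  show ?thesis using no_loops' by blast
qed

section \<open>Minimal dominating sets over an independent dominating set\<close>

text \<open>A factor outside \<open>I\<close> is adjacent to a whole factor \<open>F i\<close> with
  \<open>i\<close> in \<open>I\<close>, hence dominated by any vertex of the nonempty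
  \<open>D i\<close>. A factor inside \<open>I\<close> receives no arcs from other factors in
  \<open>I\<close>, so it must be dominated from within, and minimality carries over.\<close>

lemma minimal_dominating_set_Union:
  assumes I: "independent_set G I" "dominating_set G I"
    and D: "\<And>i. i \<in> I \<Longrightarrow> minimal_dominating_set (F i) (D i)"
  shows "minimal_dominating_set P (\<Union>i \<in> I. D i)"
  unfolding minimal_dominating_set_iff
proof (intro conjI ballI notI)
  have IG: "I \<subseteq> pverts G" using I by (simp add: dominating_set_def)
  have DF: "D i \<subseteq> pverts (F i)" if "i \<in> I" for i
    using D[OF that] by (simp add: minimal_dominating_set_def dominating_set_def)
  have D_dom: "dominating_set (F i) (D i)" if "i \<in> I" for i
    using D[OF that] by (simp add: minimal_dominating_set_def)
  show "dominating_set P (\<Union>i \<in> I. D i)"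
    unfolding dominating_set_iff
  proof (intro conjI ballI)
    show "(\<Union>i \<in> I. D i) \<subseteq> pverts P" using IG DF by (auto simp: pverts_P)
  next
    fix y assume "y \<in> pverts P"
    then obtain j where j: "j \<in> pverts G" "y \<in> pverts (F j)" by (auto simp: pverts_P)
    show "y \<in> (\<Union>i \<in> I. D i) \<or> (\<exists>x \<in> \<Union>i \<in> I. D i. (x, y) \<in> parcs P)"
    proof (cases "j \<in> I")
      case True
      then have "y \<in> D j \<or> (\<exists>x \<in> D j. (x, y) \<in> parcs (F j))"
        using D_dom j by (auto simp: dominating_set_iff)
      moreover have "(x, y) \<in> parcs P" if "x \<in> D j" "(x, y) \<in> parcs (F j)" for x
        using parcs_P_iff[of j j x y] DF[OF True] j that by auto
      ultimately show ?thesis using True by blast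
    next
      case False
      then obtain i where i: "i \<in> I" "(i, j) \<in> parcs G" using I j by (auto simp: dominating_set_def)
      obtain x where x: "x \<in> D i"
        using minimal_dominating_set_nonempty[OF D[OF i(1)]] nonempty_F IG i by blast
      have "i \<in> pverts G" "x \<in> pverts (F i)" "i \<noteq> j" using i x IG DF False by blast+
      then have "(x, y) \<in> parcs P" using parcs_P_iff[of i j x y] i j by simp
      then show ?thesis using i x by blast
    qed
  qed
  fix x assume "x \<in> (\<Union>i \<in> I. D i)" and dom: "dominating_set P ((\<Union>i \<in> I. D i) - {x})"
  then obtain i where i: "i \<in> I" "x \<in> D i" by blast
  have "dominating_set (F i) (D i - {x})"
    unfolding dominating_set_iff
  proof (intro conjI ballI)
    show "D i - {x} \<subseteq> pverts (F i)" using DF i by blast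
  next
    fix y assume y: "y \<in> pverts (F i)"
    then have "y \<in> pverts P" using IG i by (auto simp: pverts_P)
    then consider "y \<in> (\<Union>i \<in> I. D i) - {x}" | z where "z \<in> (\<Union>i \<in> I. D i) - {x}" "(z, y) \<in> parcs P"
      using dom unfolding dominating_set_iff by blast
    then show "y \<in> D i - {x} \<or> (\<exists>u \<in> D i - {x}. (u, y) \<in> parcs (F i))"
    proof cases
      case 1
      then obtain j where j: "j \<in> I" "y \<in> D j" "y \<noteq> x" by blast
      then have "j = i" using index_unique[of j i y] y i(1) IG DF[of j] by blast
      then show ?thesis using j by blast
    next
      case 2
      then obtain j where j: "j \<in> I" "z \<in> D j" "z \<noteq> x" by blast
      then have "j \<in> pverts G" "i \<in> pverts G" "z \<in> pverts (F j)" using IG DF i by blast+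
      \<comment> \<open>Independence forces the dominator \<open>z\<close> of \<open>y\<close> into
        the same factor as \<open>y\<close>.\<close>
      moreover have "(j, i) \<notin> parcs G" using I(1) i j by (simp add: independent_set_def)
      ultimately have "j = i \<and> (z, y) \<in> parcs (F i)"
        using 2(2) parcs_P_iff[of j i z y] y by (simp split: if_splits)
      then show ?thesis using j by blast
    qed
  qed
  then show False using D[OF i(1)] i(2) by (simp add: minimal_dominating_set_iff)
qed

lemma card_Union_fibres:
  assumes "I \<subseteq> pverts G" "\<And>i. i \<in> I \<Longrightarrow> D i \<subseteq> pverts (F i)"
  shows "card (\<Union>i \<in> I. D i) = (\<Sum>i \<in> I. card (D i))"
proof (rule card_UN_disjoint)
  show "finite I" using assms(1) finite_G finite_subset by blast
  show "\<forall>i \<in> I. finite (D i)"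
  proof
    fix i assume "i \<in> I"
    then show "finite (D i)" using finite_subset[OF assms(2) finite_F, of i] assms(1) by blast
  qed
  show "\<forall>i \<in> I. \<forall>j \<in> I. i \<noteq> j \<longrightarrow> D i \<inter> D j = {}"
  proof (intro ballI impI)
    fix i j assume ij: "i \<in> I" "j \<in> I" "i \<noteq> j"
    then have "pverts (F i) \<inter> pverts (F j) = {}"
      using disjoint_F assms(1) unfolding disjoint_family_on_def by blast
    then show "D i \<inter> D j = {}" using assms(2)[of i] assms(2)[of j] ij by blast
  qed
qed

section \<open>Transversals of the factors\<close>

text \<open>For a neighbour \<open>i\<close> of \<open>j\<close>, the vertex \<open>t i\<close> is
  adjacent to all of \<open>F j\<close>. Total domination is asked for because \<open>t j\<close>
  may fail to dominate the rest of its own factor.\<close>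

lemma dominating_set_transversal:
  assumes t: "\<And>i. i \<in> pverts G \<Longrightarrow> t i \<in> pverts (F i)" and S: "S \<subseteq> pverts G"
    and total: "\<And>j. j \<in> pverts G \<Longrightarrow> \<exists>i \<in> S. (i, j) \<in> parcs G"
  shows "dominating_set P (t ` S)"
  unfolding dominating_set_iff
proof (intro conjI ballI disjI2)
  show "t ` S \<subseteq> pverts P" using t S by (auto simp: pverts_P)
next
  fix y assume "y \<in> pverts P"
  then obtain j where j: "j \<in> pverts G" "y \<in> pverts (F j)" by (auto simp: pverts_P)
  then obtain i where i: "i \<in> S" "(i, j) \<in> parcs G" using total by blast
  then have "i \<noteq> j" using no_loop_G by blast
  then have "(t i, y) \<in> parcs P" using parcs_P_iff[of i j "t i" y] i j t S by auto
  then show "\<exists>x \<in> t ` S. (x, y) \<in> parcs P" using i by blast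
qed

lemma inj_on_transversal:
  assumes "\<And>i. i \<in> pverts G \<Longrightarrow> t i \<in> pverts (F i)"
  shows "inj_on t (pverts G)"
proof (rule inj_onI)
  fix i j assume "i \<in> pverts G" "j \<in> pverts G" "t i = t j"
  then show "i = j" using index_unique[of i j "t i"] assms[of i] assms[of j] by simp
qed

text \<open>With complete factors \<open>t i\<close> also dominates its own factor, so
  \<open>t i\<close> dominates a vertex of \<open>F j\<close> exactly when \<open>i\<close> equals
  or is adjacent to \<open>j\<close>. Ordinary domination in \<open>G\<close> then suffices.\<close>

lemma dominating_set_transversal_iff:
  assumes t: "\<And>i. i \<in> pverts G \<Longrightarrow> t i \<in> pverts (F i)" and S: "S \<subseteq> pverts G"
    and complete: "\<And>i. i \<in> pverts G \<Longrightarrow> complete_graph (F i)"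
  shows "dominating_set P (t ` S) \<longleftrightarrow> dominating_set G S"
proof -
  have dominated_iff: "y \<in> t ` S \<or> (\<exists>x \<in> t ` S. (x, y) \<in> parcs P) \<longleftrightarrow>
      j \<in> S \<or> (\<exists>i \<in> S. (i, j) \<in> parcs G)" if j: "j \<in> pverts G" "y \<in> pverts (F j)" for j y
  proof -
    have "y = t i \<or> (t i, y) \<in> parcs P \<longleftrightarrow> i = j \<or> (i, j) \<in> parcs G" if "i \<in> S" for i
    proof (cases "i = j")
      case True
      then show ?thesis
        using complete_factor_arc[OF j(1) complete[OF j(1)] t[OF j(1)] j(2)] by simp
    next
      case False
      then show ?thesis
        using parcs_P_iff[of i j "t i" y] index_unique[of i j y] j t S that by auto
    qed
    then show ?thesis by blast
  qed
  have "t ` S \<subseteq> pverts P" using t S by (auto simp: pverts_P)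
  then have "dominating_set P (t ` S) \<longleftrightarrow>
      (\<forall>j \<in> pverts G. \<forall>y \<in> pverts (F j). y \<in> t ` S \<or> (\<exists>x \<in> t ` S. (x, y) \<in> parcs P))"
    unfolding dominating_set_iff by (auto simp: pverts_P)
  also have "\<dots> \<longleftrightarrow> (\<forall>j \<in> pverts G. \<forall>y \<in> pverts (F j). j \<in> S \<or> (\<exists>i \<in> S. (i, j) \<in> parcs G))"
    using dominated_iff by (intro ball_cong refl) blast
  \<comment> \<open>The condition no longer mentions \<open>y\<close>, and every \<open>F j\<close>
    is nonempty.\<close>
  also have "\<dots> \<longleftrightarrow> dominating_set G S"
    using nonempty_F S unfolding dominating_set_iff by blast
  finally show ?thesis .
qed

text \<open>Since \<open>t\<close> is injective on the indices, deleting \<open>t i\<close> from the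
  image is deleting \<open>i\<close> from \<open>S\<close>, so the test by single removals
  transfers.\<close>

lemma minimal_dominating_set_transversal_iff:
  assumes t: "\<And>i. i \<in> pverts G \<Longrightarrow> t i \<in> pverts (F i)" and S: "S \<subseteq> pverts G"
    and complete: "\<And>i. i \<in> pverts G \<Longrightarrow> complete_graph (F i)"
  shows "minimal_dominating_set P (t ` S) \<longleftrightarrow> minimal_dominating_set G S"
proof -
  have "t ` S - {t i} = t ` (S - {i})" if "i \<in> S" for i
    using inj_on_transversal[of t, OF t] S that by (auto dest: inj_onD)
  then have "dominating_set P (t ` S - {t i}) \<longleftrightarrow> dominating_set G (S - {i})" if "i \<in> S" for i
    using dominating_set_transversal_iff[of t "S - {i}", OF t _ complete] S that by auto
  then show ?thesis
    unfolding minimal_dominating_set_iff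
    using dominating_set_transversal_iff[of t S, OF t S complete] by auto
qed

text \<open>Vertices of one complete factor have the same closed neighbourhood in the product. One
  representative from each factor that \<open>D\<close> meets therefore dominates as much as
  \<open>D\<close>, and minimality leaves nothing else in \<open>D\<close>.\<close>

lemma minimal_dominating_set_is_transversal:
  assumes complete: "\<And>i. i \<in> pverts G \<Longrightarrow> complete_graph (F i)"
    and D: "minimal_dominating_set P D"
  obtains t S where "\<And>i. i \<in> pverts G \<Longrightarrow> t i \<in> pverts (F i)" "S \<subseteq> pverts G" "D = t ` S"
proof -
  define S where "S = {i \<in> pverts G. D \<inter> pverts (F i) \<noteq> {}}"
  \<comment> \<open>The representative lies in \<open>D\<close> wherever \<open>D\<close> meets the
    factor and is arbitrary elsewhere, so that \<open>t\<close> is defined on all indices.\<close>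
  define t where "t i = (SOME x. x \<in> pverts (F i) \<and> (i \<in> S \<longrightarrow> x \<in> D))" for i
  have t: "t i \<in> pverts (F i) \<and> (i \<in> S \<longrightarrow> t i \<in> D)" if "i \<in> pverts G" for i
  proof -
    have "\<exists>x. x \<in> pverts (F i) \<and> (i \<in> S \<longrightarrow> x \<in> D)"
      using nonempty_F[OF that] unfolding S_def by blast
    then show ?thesis unfolding t_def by (rule someI_ex)
  qed
  have DP: "dominating_set P D" using D by (simp add: minimal_dominating_set_def)
  have "dominating_set P (t ` S)"
    unfolding dominating_set_iff
  proof (intro conjI ballI)
    show "t ` S \<subseteq> pverts P" using t by (auto simp: pverts_P S_def)
  next
    fix y assume y: "y \<in> pverts P"
    then obtain j where j: "j \<in> pverts G" "y \<in> pverts (F j)" by (auto simp: pverts_P)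
    obtain x where x: "x \<in> D" "y = x \<or> (x, y) \<in> parcs P"
      using DP y by (auto simp: dominating_set_iff)
    then obtain i where i: "i \<in> pverts G" "x \<in> pverts (F i)"
      using DP by (auto simp: dominating_set_iff pverts_P)
    then have "i \<in> S" using x by (auto simp: S_def)
    have "y = t i \<or> (t i, y) \<in> parcs P"
    proof (cases "i = j")
      case True
      then show ?thesis
        using complete_factor_arc[OF j(1) complete[OF j(1)] _ j(2), of "t j"] t[OF j(1)] by simp
    next
      case False
      then show ?thesis
        using parcs_P_iff[of i j x y] parcs_P_iff[of i j "t i" y] index_unique[of i j y] i j t x by auto
    qed
    then show "y \<in> t ` S \<or> (\<exists>x \<in> t ` S. (x, y) \<in> parcs P)" using \<open>i \<in> S\<close> by blast
  qed
  moreover have "t ` S \<subseteq> D" using t by (auto simp: S_def)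
  ultimately have "D = t ` S" using D by (auto simp: minimal_dominating_set_def)
  then show thesis using t by (intro that[of t S]) (auto simp: S_def)
qed

text \<open>Transversals preserve cardinality and minimality in both directions: every minimal
  dominating set of the product is one, and a single fixed \<open>t\<close> lifts all those of
  \<open>G\<close>.\<close>

lemma well_dominated_iff_if_complete_factors:
  assumes complete: "\<And>i. i \<in> pverts G \<Longrightarrow> complete_graph (F i)"
  shows "well_dominated P \<longleftrightarrow> well_dominated G"
proof
  assume G: "well_dominated G"
  show "well_dominated P"
  proof (rule well_dominatedI[OF finite_P])
    fix D assume D: "minimal_dominating_set P D"
    then obtain t S where t: "\<And>i. i \<in> pverts G \<Longrightarrow> t i \<in> pverts (F i)" and S: "S \<subseteq> pverts G" "D = t ` S"
      using minimal_dominating_set_is_transversal[OF complete] by metis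
    then have "minimal_dominating_set G S"
      using minimal_dominating_set_transversal_iff[of t S, OF t S(1) complete] D by simp
    moreover have "card D = card S"
      using S inj_on_transversal[of t, OF t] by (auto intro: card_image inj_on_subset)
    ultimately show "card D = domination_number G" using well_dominated_card[OF finite_G G] by simp
  qed
next
  assume P: "well_dominated P"
  obtain t where t: "\<And>i. i \<in> pverts G \<Longrightarrow> t i \<in> pverts (F i)"
    using ex_transversal by blast
  show "well_dominated G"
  proof (rule well_dominatedI[OF finite_G])
    fix S assume S: "minimal_dominating_set G S"
    then have SG: "S \<subseteq> pverts G" by (simp add: minimal_dominating_set_def dominating_set_def)
    then have "minimal_dominating_set P (t ` S)"
      using minimal_dominating_set_transversal_iff[of t S, OF t SG complete] S by simp
    moreover have "card (t ` S) = card S"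
      using SG inj_on_transversal[of t, OF t] by (auto intro: card_image inj_on_subset)
    ultimately show "card S = domination_number P" using well_dominated_card[OF finite_P P] by metis
  qed
qed

section \<open>Products over a complete graph\<close>

text \<open>Either \<open>D\<close> lies in one factor and is a minimal dominating set there, or it
  contains two vertices from different factors, and these already dominate the product.\<close>

lemma minimal_dominating_set_card_2_if_complete:
  assumes complete: "complete_graph G" and G2: "card (pverts G) \<ge> 2"
    and F: "\<And>i. i \<in> pverts G \<Longrightarrow> well_dominated (F i)"
      "\<And>i. i \<in> pverts G \<Longrightarrow> domination_number (F i) = 2"
    and D: "minimal_dominating_set P D"
  shows "card D = 2"
proof -
  have DP: "D \<subseteq> pverts P"
    using D by (simp add: minimal_dominating_set_def dominating_set_def)
  have adj: "(i, j) \<in> parcs G" if "i \<in> pverts G" "j \<in> pverts G" "i \<noteq> j" for i j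
    using complete complete_graph_iff[OF graph_G] that by blast
  have "pverts P \<noteq> {}" using G2 nonempty_F by (auto simp: pverts_P)
  then have "D \<noteq> {}" using minimal_dominating_set_nonempty[OF D] by blast
  then obtain x where "x \<in> D" by blast
  with DP obtain i where x: "x \<in> D" "i \<in> pverts G" "x \<in> pverts (F i)"
    by (auto simp: pverts_P)
  show ?thesis
  proof (cases "D \<subseteq> pverts (F i)")
    case True
    have dom_iff: "dominating_set P E \<longleftrightarrow> dominating_set (F i) E" if E: "E \<subseteq> pverts (F i)" for E
    proof
      assume "dominating_set P E"
      then show "dominating_set (F i) E"
        unfolding dominating_set_iff
      proof (intro conjI ballI E)
        fix y assume y: "y \<in> pverts (F i)"
        then have "y \<in> pverts P" using x by (auto simp: pverts_P)
        then have "y \<in> E \<or> (\<exists>u \<in> E. (u, y) \<in> parcs P)"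
          using \<open>dominating_set P E\<close> by (simp add: dominating_set_iff)
        moreover have "(u, y) \<in> parcs (F i)" if "u \<in> E" "(u, y) \<in> parcs P" for u
          using parcs_P_iff[of i i u y] x(2) y E that by auto
        ultimately show "y \<in> E \<or> (\<exists>u \<in> E. (u, y) \<in> parcs (F i))" by blast
      qed
    next
      assume E_dom: "dominating_set (F i) E"
      \<comment> \<open>As \<open>G\<close> is complete, any single vertex of \<open>F i\<close>
        dominates all the other factors.\<close>
      then obtain e where e: "e \<in> E" using x by (auto simp: dominating_set_iff)
      show "dominating_set P E"
        unfolding dominating_set_iff
      proof (intro conjI ballI)
        show "E \<subseteq> pverts P" using E x by (auto simp: pverts_P)
      next
        fix y assume "y \<in> pverts P"
        then obtain j where j: "j \<in> pverts G" "y \<in> pverts (F j)" by (auto simp: pverts_P)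
        show "y \<in> E \<or> (\<exists>u \<in> E. (u, y) \<in> parcs P)"
        proof (cases "i = j")
          case True
          then have "y \<in> E \<or> (\<exists>u \<in> E. (u, y) \<in> parcs (F i))"
            using E_dom j by (simp add: dominating_set_iff)
          moreover have "(u, y) \<in> parcs P" if "u \<in> E" "(u, y) \<in> parcs (F i)" for u
            using parcs_P_iff[of i i u y] x(2) j True E that by auto
          ultimately show ?thesis by blast
        next
          case False
          then have "(e, y) \<in> parcs P"
            using parcs_P_iff[of i j e y] adj[of i j] subsetD[OF E e] j x(2) by simp
          then show ?thesis using e by blast
        qed
      qed
    qed
    have "D - {z} \<subseteq> pverts (F i)" for z using True by blast
    then have "minimal_dominating_set (F i) D"
      using D dom_iff[OF True] dom_iff[of "D - {_}"] unfolding minimal_dominating_set_iff by simp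
    then show ?thesis using well_dominated_card[OF finite_F[OF x(2)] F(1)[OF x(2)]] F(2)[OF x(2)] by simp
  next
    case False
    then obtain y where "y \<in> D" "y \<notin> pverts (F i)" by blast
    with DP obtain j where y: "y \<in> D" "j \<in> pverts G" "y \<in> pverts (F j)" "i \<noteq> j"
      by (auto simp: pverts_P)
    \<comment> \<open>Each index differs from \<open>i\<close> or from \<open>j\<close>, so
      \<open>x\<close> or \<open>y\<close> is adjacent to the whole factor at that index.\<close>
    have "dominating_set P {x, y}"
      unfolding dominating_set_iff
    proof (intro conjI ballI)
      show "{x, y} \<subseteq> pverts P" using x y by (auto simp: pverts_P)
    next
      fix z assume "z \<in> pverts P"
      then obtain l where l: "l \<in> pverts G" "z \<in> pverts (F l)" by (auto simp: pverts_P)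
      show "z \<in> {x, y} \<or> (\<exists>u \<in> {x, y}. (u, z) \<in> parcs P)"
        using parcs_P_iff[of i l x z] parcs_P_iff[of j l y z] adj[of i l] adj[of j l] x y l
        by (cases "i = l") auto
    qed
    then have "\<not> {x, y} \<subset> D" using D unfolding minimal_dominating_set_def by blast
    then have "D = {x, y}" using x(1) y(1) by blast
    moreover have "x \<noteq> y" using x y index_unique by blast
    ultimately show ?thesis by simp
  qed
qed

section \<open>Consequences of a well-dominated product\<close>

text \<open>Over an independent dominating set through \<open>i\<close>, fix the sets chosen in the
  other factors and vary only the one in \<open>F i\<close>. The total is constant, hence so is the
  varying part.\<close>

lemma factor_well_dominated:
  assumes P: "well_dominated P" and i: "i \<in> pverts G"
  shows "well_dominated (F i)"
proof -
  have "independent_set G {i}" using i no_loop_G by (auto simp: independent_set_def)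
  then obtain I where I: "{i} \<subseteq> I" "independent_set G I" "dominating_set G I"
    using independent_set_extends[OF graph_G] by blast
  have IG: "I \<subseteq> pverts G" using I by (simp add: dominating_set_def)
  obtain D where D: "\<And>j. j \<in> pverts G \<Longrightarrow> minimal_dominating_set (F j) (D j)"
    using bchoice[of "pverts G" "\<lambda>j D. minimal_dominating_set (F j) D"]
      ex_minimal_dominating_set[OF finite_F] by blast
  define r where "r = (\<Sum>j \<in> I - {i}. card (D j))"
  show ?thesis
  proof (rule well_dominatedI[OF finite_F[OF i]])
    fix E assume E: "minimal_dominating_set (F i) E"
    have m: "minimal_dominating_set (F j) ((D(i := E)) j)" if "j \<in> I" for j
      using D E IG that by auto
    then have "(D(i := E)) j \<subseteq> pverts (F j)" if "j \<in> I" for j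
      using that by (simp add: minimal_dominating_set_def dominating_set_def)
    then have "card (\<Union>j \<in> I. (D(i := E)) j) = (\<Sum>j \<in> I. card ((D(i := E)) j))"
      by (intro card_Union_fibres IG)
    also have "\<dots> = card E + r"
      using I(1) finite_subset[OF IG finite_G] by (simp add: r_def sum.remove[of I i])
    \<comment> \<open>The subtraction is exact: \<open>card E + r\<close> is the size of a minimal
      dominating set of the product.\<close>
    finally show "card E = domination_number P - r"
      using well_dominated_card[OF finite_P P minimal_dominating_set_Union[OF I(2,3) m]] by simp
  qed
qed

text \<open>Minimum dominating sets of the factors over \<open>I\<close> form one minimal dominating
  set of the product, and well-domination makes its size the domination number.\<close>

lemma domination_number_eq_if_well_dominated:
  assumes P: "well_dominated P" and k: "\<And>i. i \<in> pverts G \<Longrightarrow> domination_number (F i) = k"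
    and I: "independent_set G I" "dominating_set G I"
  shows "domination_number P = k * card I"
proof -
  have IG: "I \<subseteq> pverts G" using I by (simp add: dominating_set_def)
  have "\<exists>D. minimal_dominating_set (F j) D \<and> card D = k" if "j \<in> pverts G" for j
    using domination_number_attained[OF finite_F[OF that]] k[OF that] by metis
  then obtain D where D: "\<And>j. j \<in> pverts G \<Longrightarrow> minimal_dominating_set (F j) (D j)"
      "\<And>j. j \<in> pverts G \<Longrightarrow> card (D j) = k"
    using bchoice[of "pverts G" "\<lambda>j D. minimal_dominating_set (F j) D \<and> card D = k"] by blast
  have "minimal_dominating_set P (\<Union>j \<in> I. D j)"
    using minimal_dominating_set_Union[OF I] D IG by blast
  moreover have "D j \<subseteq> pverts (F j)" if "j \<in> I" for j
    using D(1) IG that by (auto simp: minimal_dominating_set_def dominating_set_def)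
  then have "card (\<Union>j \<in> I. D j) = (\<Sum>j \<in> I. card (D j))" by (intro card_Union_fibres IG)
  moreover have "(\<Sum>j \<in> I. card (D j)) = (\<Sum>j \<in> I. k)" using D(2) IG by (intro sum.cong) auto
  ultimately show ?thesis using well_dominated_card[OF finite_P P] by (simp add: mult.commute)
qed

lemma domination_number_le_total:
  assumes I: "dominating_set G I" and nb: "\<And>i. i \<in> I \<Longrightarrow> (i, nb i) \<in> parcs G"
  shows "domination_number P \<le> card I + card (nb ` I)"
proof -
  interpret G: pair_graph G by (rule graph_G)
  obtain t where t: "\<And>i. i \<in> pverts G \<Longrightarrow> t i \<in> pverts (F i)"
    using ex_transversal by blast
  have IG: "I \<subseteq> pverts G" using I by (simp add: dominating_set_def)
  have S: "I \<union> nb ` I \<subseteq> pverts G" using IG nb G.in_arcsD2 by blast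
  have "\<exists>i \<in> I \<union> nb ` I. (i, j) \<in> parcs G" if "j \<in> pverts G" for j
    using I that nb[of j] G.arcs_symmetric[of j "nb j"] by (cases "j \<in> I") (auto simp: dominating_set_def)
  then have "dominating_set P (t ` (I \<union> nb ` I))" by (intro dominating_set_transversal t S)
  then have "domination_number P \<le> card (t ` (I \<union> nb ` I))" by (rule domination_number_le[OF finite_P])
  also have "\<dots> \<le> card (I \<union> nb ` I)" using finite_subset[OF S finite_G] by (rule card_image_le)
  also have "\<dots> \<le> card I + card (nb ` I)" by (rule card_Un_le)
  finally show ?thesis .
qed

text \<open>Both conclusions compare the exact value \<open>k * card I\<close> with the total
  domination bound. A shared neighbour makes that bound less than \<open>2 * card I\<close>, which
  rules out an induced path.\<close>

lemma well_dominated_imp_complete: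
  assumes P: "well_dominated P" and k: "\<And>i. i \<in> pverts G \<Longrightarrow> domination_number (F i) = k" "k \<ge> 2"
    and G: "Digraph_Component.connected (with_proj G)" "card (pverts G) \<ge> 2"
  shows "complete_graph G" "k = 2"
proof -
  interpret G: pair_graph G by (rule graph_G)
  obtain nb where nb: "\<And>i. i \<in> pverts G \<Longrightarrow> (i, nb i) \<in> parcs G"
    using connected_has_neighbour[OF graph_G G] by metis
  show "complete_graph G"
  proof (rule connected_transitive_imp_complete[OF graph_G G(1)], rule ccontr)
    fix u v w assume uvw: "(u, v) \<in> parcs G" "(v, w) \<in> parcs G" "u \<noteq> w" "(u, w) \<notin> parcs G"
    then have "independent_set G {u, w}"
      using G.in_arcsD1 G.in_arcsD2 G.arcs_symmetric no_loop_G by (auto simp: independent_set_def)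
    then obtain I where I: "{u, w} \<subseteq> I" "independent_set G I" "dominating_set G I"
      using independent_set_extends[OF graph_G] by blast
    have IG: "I \<subseteq> pverts G" using I by (simp add: dominating_set_def)
    then have fin: "finite I" using finite_G finite_subset by blast
    \<comment> \<open>Both ends of the induced path are assigned its middle vertex.\<close>
    let ?nb = "nb(u := v, w := v)"
    have "(i, ?nb i) \<in> parcs G" if "i \<in> I" for i
      using that uvw nb IG G.arcs_symmetric by auto
    then have "k * card I \<le> card I + card (?nb ` I)"
      using domination_number_le_total[OF I(3), of ?nb] domination_number_eq_if_well_dominated[OF P k(1) I(2,3)]
      by simp
    \<comment> \<open>The value \<open>v\<close> is still attained at \<open>w\<close>, so dropping
      \<open>u\<close> loses nothing and saves one in the count.\<close>
    also have "?nb ` I = ?nb ` (I - {u})"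
      using I(1) uvw(3) by force
    also have "card (?nb ` (I - {u})) \<le> card (I - {u})" using fin by (intro card_image_le) simp
    also have "\<dots> < card I" using fin I(1) by (intro card_Diff1_less) auto
    finally have "k * card I < 2 * card I" by (simp only: mult_2)
    then show False using k(2) by simp
  qed
  obtain I where I: "independent_set G I" "dominating_set G I"
    using independent_set_extends[OF graph_G, of "{}"] by (auto simp: independent_set_def)
  have IG: "I \<subseteq> pverts G" using I by (simp add: dominating_set_def)
  then have fin: "finite I" using finite_G finite_subset by blast
  have "k * card I \<le> card I + card (nb ` I)"
    using domination_number_le_total[OF I(2), of nb] nb IG domination_number_eq_if_well_dominated[OF P k(1) I]
    by auto
  also have "\<dots> \<le> 2 * card I" using card_image_le[OF fin, of nb] by simp
  finally have "k * card I \<le> 2 * card I" .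
  \<comment> \<open>Nonemptiness of \<open>I\<close> is what allows \<open>card I\<close> to be
    cancelled.\<close>
  moreover have "pverts G \<noteq> {}" using G(2) by auto
  then have "I \<noteq> {}" using I(2) by (auto simp: dominating_set_iff)
  then have "card I > 0" using fin by (simp add: card_gt_0_iff)
  ultimately show "k = 2" using k(2) by simp
qed

end

theorem theorem3p8:
  fixes n :: nat
    and G :: "nat pair_pre_digraph"
    and F :: "nat \<Rightarrow> 'a pair_pre_digraph"
  assumes "n \<ge> 2"
    and "pair_graph G"
    and "pverts G = {1..n}"
    and "Digraph_Component.connected (with_proj G)"
    and "\<And>i. i \<in> {1..n} \<Longrightarrow> pair_graph (F i)"
    and "disjoint_family_on (\<lambda>i. pverts (F i)) {1..n}"
    and "\<And>i. i \<in> {1..n} \<Longrightarrow> card (pverts (F i)) \<ge> 2"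
    and "\<And>i j. i \<in> {1..n} \<Longrightarrow> j \<in> {1..n} \<Longrightarrow>
           domination_number (F i) = domination_number (F j)"
    and "\<And>i j. i \<in> {1..n} \<Longrightarrow> j \<in> {1..n} \<Longrightarrow>
           upper_domination_number (F i) = upper_domination_number (F j)"
  shows "well_dominated (gen_lex_product G F) \<longleftrightarrow>
           (well_dominated G \<and> (\<forall>i \<in> {1..n}. complete_graph (F i))) \<or>
           (complete_graph G \<and>
             (\<forall>i \<in> {1..n}. well_dominated (F i) \<and> domination_number (F i) = 2))"
proof -
  note V = assms(3)
  interpret gen_lex G F
  proof (rule gen_lex.intro)
    show "pair_graph (F i)" if "i \<in> pverts G" for i using assms(5)[of i] V that by simp
    show "pverts (F i) \<noteq> {}" if "i \<in> pverts G" for i using assms(7)[of i] V that by auto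
    show "disjoint_family_on (\<lambda>i. pverts (F i)) (pverts G)" using assms(6) V by simp
  qed (rule assms(2))
  have G2: "card (pverts G) \<ge> 2" using assms(1) V by simp
  have one: "1 \<in> pverts G" using assms(1) V by simp
  define k where "k = domination_number (F 1)"
  have k: "domination_number (F i) = k" if "i \<in> pverts G" for i
    using assms(8)[of i 1] one that V by (simp add: k_def)
  have complete_case: "well_dominated P" if "complete_graph G"
      "\<And>i. i \<in> pverts G \<Longrightarrow> well_dominated (F i)" "\<And>i. i \<in> pverts G \<Longrightarrow> domination_number (F i) = 2"
    using minimal_dominating_set_card_2_if_complete[OF that(1) G2 that(2,3)] well_dominatedI[OF finite_P] by blast
  show ?thesis
  \<comment> \<open>With all factors complete, the first alternative is equivalent to
    well-domination of the product and the second still implies it. Otherwise only the second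
    alternative can hold.\<close>
  proof (cases "\<forall>i \<in> pverts G. complete_graph (F i)")
    case True
    then show ?thesis
      using complete_case well_dominated_iff_if_complete_factors V by blast
  next
    case False
    then obtain i where i: "i \<in> pverts G" "\<not> complete_graph (F i)" by blast
    have "complete_graph G \<and> (\<forall>i \<in> pverts G. well_dominated (F i) \<and> domination_number (F i) = 2)"
      if P: "well_dominated P"
    proof -
      have "\<not> upper_domination_number (F i) \<le> 1"
        using complete_graph_if_upper_domination_number_le_1[OF graph_F] i by blast
      \<comment> \<open>The upper domination number of the incomplete factor exceeds 1, and it
        equals \<open>k\<close> because that factor is well-dominated.\<close>
      then have "k \<ge> 2"
        using factor_well_dominated[OF P i(1)] k[OF i(1)] by (simp add: well_dominated_def)
      from well_dominated_imp_complete[OF P k this assms(4) G2] show ?thesis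
        using factor_well_dominated[OF P] k by blast
    qed
    then show ?thesis using False complete_case V by blast
  qed
qed

end
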